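(* Let $\mathbf{a}=(a_1,a_2,\ldots,a_n)$ be a weak composition of $n$ that is the content of a Fubini ranking with $n$ competitors. Let $a$ be the median entry of a Fubini ranking with content $\mathbf{a}$, let $m_a$ be the number of its entries strictly less than $a$, and let $M_a$ be the number of its entries strictly greater than $a$ (these depend only on $\mathbf{a}$). Let $R$ be the maximum possible number of runs of weak ascents in $f$, where $f$ ranges over all weakly flattened Fubini rankings with runs of weak ascents having content $\mathbf{a}$. Then exactly one of the following holds. (1) $m_a=M_a=0$, and $R=1$. (2) $0=m_a<M_a$, and $R=M_a+1$. (3) $0=M_a<m_a$, and $R=m_a$. (4) $m_a,M_a>0$, and $R=\min\left(m_a+M_a,\lceil \tfrac n2\rceil\right)$.
   Context: Let $[n]=\{1,2,\ldots,n\}$. A Fubini ranking of length $n$ (with $n$ competitors) is a tuple $r=(r_1,\ldots,r_n)\in[n]^n$ that records a valid ranking of $n$ competitors with ties allowed, where if exactly $k$ competitors are tied at rank $i$, then the next $k-1$ ranks $i+1,\ldots,i+k-1$ are disallowed; equivalently, $r_i=1+|\{j : r_j<r_i\}|$ for every $i\in[n]$. The content of a Fubini ranking of length $n$ is the tuple $(a_1,\ldots,a_n)$ where $a_i$ is the number of entries equal to $i$. A run of weak ascents of a word $w=w_1\cdots w_n$ is a maximal contiguous subword $w_iw_{i+1}\cdots w_j$ with $w_l\le w_{l+1}$ for all $i\le l\le j-1$. A Fubini ranking is weakly flattened with runs of weak ascents if the leading (first) terms of its runs of weak ascents, read from left to right, are in weakly increasing order. If $f_1'\le f_2'\le\cdots\le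 f_n'$ is the weakly increasing rearrangement of the entries of $f$, the median of $f$ is $f'_{x+1}$ if $n=2x+1$ is odd, and the arithmetic mean of $f'_x$ and $f'_{x+1}$ if $n=2x$ is even. *)

theory Defs
  imports Complex_Main
begin

text \<open>
  Words are lists of natural numbers, so positions count from 0: the letter \<open>w\<^sub>i\<close> of the
  mathematical notation is \<open>w ! (i - 1)\<close>. The letters (ranks) themselves lie in \<open>{1..n}\<close>.
\<close>

definition fubini_ranking :: "nat \<Rightarrow> nat list \<Rightarrow> bool" where
  "fubini_ranking n r \<longleftrightarrow>
     length r = n \<and> set r \<subseteq> {1..n} \<and>
     (\<forall>i<n. r ! i = 1 + card {j. j < n \<and> r ! j < r ! i})"

definition content :: "nat list \<Rightarrow> nat list" where
  "content r = map (count_list r) [1..<length r + 1]"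

text \<open>Weak compositions of \<open>n\<close> with exactly \<open>n\<close> parts, zero parts being allowed.\<close>

definition weak_composition :: "nat \<Rightarrow> nat list \<Rightarrow> bool" where
  "weak_composition n a \<longleftrightarrow> length a = n \<and> sum_list a = n"

definition weakly_ascending :: "nat list \<Rightarrow> nat \<Rightarrow> nat \<Rightarrow> bool" where
  "weakly_ascending w i j \<longleftrightarrow>
     i \<le> j \<and> j < length w \<and> (\<forall>l. i \<le> l \<and> l < j \<longrightarrow> w ! l \<le> w ! (l + 1))"

text \<open>A run is represented by the pair of its first and last position (both inclusive).\<close>

definition weak_ascent_runs :: "nat list \<Rightarrow> (nat \<times> nat) set" where
  "weak_ascent_runs w =
     {(i, j). weakly_ascending w i j \<and>
        (\<forall>i' j'. i' \<le> i \<and> j \<le> j' \<and> weakly_ascending w i' j' \<longrightarrow> i' = i \<and> j' = j)}"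

definition weakly_flattened :: "nat list \<Rightarrow> bool" where
  "weakly_flattened w \<longleftrightarrow>
     (\<forall>(i, j) \<in> weak_ascent_runs w. \<forall>(i', j') \<in> weak_ascent_runs w. i < i' \<longrightarrow> w ! i \<le> w ! i')"

text \<open>Meaningful only for nonempty \<open>f\<close>; for even length the median need not be an integer.\<close>

definition median :: "nat list \<Rightarrow> real" where
  "median f =
     (let s = sort f; x = length f div 2 in
      if odd (length f) then real (s ! x) else (real (s ! (x - 1)) + real (s ! x)) / 2)"

definition num_below_median :: "nat list \<Rightarrow> nat" where
  "num_below_median f = card {i. i < length f \<and> real (f ! i) < median f}"

definition num_above_median :: "nat list \<Rightarrow> nat" where
  "num_above_median f = card {i. i < length f \<and> real (f ! i) > median f}"

text \<open>
  The set below is finite, and it is nonempty whenever \<open>a\<close> is the content of some Fubini ranking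
  of length \<open>n\<close>, since sorting that ranking yields a weakly flattened one. So \<open>Max\<close> is then a
  genuine maximum.
\<close>

definition max_runs :: "nat \<Rightarrow> nat list \<Rightarrow> nat" where
  "max_runs n a =
     Max {card (weak_ascent_runs f) | f.
            fubini_ranking n f \<and> weakly_flattened f \<and> content f = a}"

end

theory Submission
  imports Defs "HOL-Library.Multiset"
begin

text \<open>
  A run of weak ascents starts at position 0 or just after a descent, so the number of runs is one
  more than the number of descents. Being a Fubini ranking and having a given content depend only on
  the multiset of letters, so the question is how many descents a weakly flattened rearrangement of
  a given multiset can have. Let \<open>c\<close> be the median and \<open>m\<close>, \<open>M\<close> the numbers of letters below and
  above it.

  Upper bounds. In a weakly flattened word the first letter is minimal and there are never two
  descents in a row, because the two descent bottoms would be consecutive leading terms in the wrong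
  order. Hence the pairs (descent top, descent bottom) occupy disjoint pairs of positions, none of
  them containing position 0. Counting positions gives at most \<open>(n - 1) div 2\<close> descents. As
  the two letters of a descent differ, each pair contains a letter different from \<open>c\<close>, so the number
  of descents is at most the number of letters different from \<open>c\<close> at positions other than 0. This
  number is \<open>m + M - 1\<close> if \<open>m > 0\<close>, since then the first letter is below \<open>c\<close>, and it is at most
  \<open>M\<close> if \<open>m = 0\<close>. The lemma \<open>card_descents_le\<close> collects these bounds.

  Construction. Let \<open>s\<close> be the sorted word and let \<open>k\<close> be the smaller of the two bounds. Interleave
  the \<open>k\<close> smallest letters with the \<open>k\<close> largest ones, each group in increasing order, and append the
  remaining middle letters in increasing order. The leading terms are then \<open>s\<close>'s \<open>k + 1\<close> smallest
  letters in order, and there are \<open>k\<close> descents provided that each large letter exceeds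
  the small letter after it. If it did not, then \<open>s\<close> would be constant on a stretch of \<open>n - k\<close>
  positions; as \<open>k < n / 2\<close>, this stretch covers the middle of \<open>s\<close>, so its value is \<open>c\<close>. The
  stretch does not contain position 0, where \<open>c\<close> also stands if \<open>m = 0\<close>; so in either case \<open>c\<close>
  would occur more often than \<open>n - m - M\<close> times (lemma \<open>sorted_gap\<close>).

  All four cases are instances of the resulting formula (lemma \<open>max_runs_eq\<close>). When \<open>m\<close> or \<open>M\<close>
  vanishes, the median value fills more than half of the word, so that the bound by \<open>n\<close> is implied
  by the other one.
\<close>

section \<open>Runs and descents\<close>

definition descents :: "nat list \<Rightarrow> nat set" where
  "descents w = {i. Suc i < length w \<and> w ! Suc i < w ! i}"

definition run_starts :: "nat list \<Rightarrow> nat set" where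
  "run_starts w = insert 0 (Suc ` descents w)"

lemma finite_descents: "finite (descents w)"
  by (rule finite_subset[of _ "{..<length w}"]) (auto simp: descents_def)

lemma inj_on_fst_runs: "inj_on fst (weak_ascent_runs w)"
proof (rule inj_onI)
  fix p q assume p: "p \<in> weak_ascent_runs w" and q: "q \<in> weak_ascent_runs w" and e: "fst p = fst q"
  obtain i j j' where ij: "p = (i, j)" "q = (i, j')"
    using e by (metis fst_conv surj_pair)
  consider "j \<le> j'" | "j' \<le> j" by linarith
  then show "p = q"
    using p q unfolding ij weak_ascent_runs_def by cases blast+
qed

lemma fst_runs_eq_run_starts:
  assumes "w \<noteq> []"
  shows "fst ` weak_ascent_runs w = run_starts w"
proof (intro equalityI subsetI)
  fix i assume "i \<in> fst ` weak_ascent_runs w"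
  then obtain j where asc: "weakly_ascending w i j"
    and maximal: "\<And>i' j'. i' \<le> i \<Longrightarrow> j \<le> j' \<Longrightarrow> weakly_ascending w i' j' \<Longrightarrow> i' = i \<and> j' = j"
    by (auto simp: weak_ascent_runs_def)
  show "i \<in> run_starts w"
  proof (cases i)
    case 0
    then show ?thesis by (simp add: run_starts_def)
  next
    case (Suc p)
    have "p \<in> descents w"
    proof (rule ccontr)
      assume "p \<notin> descents w"
      with asc Suc have le: "w ! p \<le> w ! Suc p"
        by (auto simp: descents_def weakly_ascending_def)
      have "weakly_ascending w p j"
        unfolding weakly_ascending_def
      proof (intro conjI allI impI)
        fix l assume "p \<le> l \<and> l < j"
        then show "w ! l \<le> w ! (l + 1)"
          using le asc Suc by (cases "l = p") (auto simp: weakly_ascending_def)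
      qed (use asc Suc in \<open>auto simp: weakly_ascending_def\<close>)
      with maximal[of p j] Suc show False by simp
    qed
    with Suc show ?thesis by (simp add: run_starts_def)
  qed
next
  fix i assume start: "i \<in> run_starts w"
  let ?J = "{j. weakly_ascending w i j}"
  have fin: "finite ?J"
    by (rule finite_subset[of _ "{..<length w}"]) (auto simp: weakly_ascending_def)
  have "i < length w"
    using start assms by (auto simp: run_starts_def descents_def)
  then have "i \<in> ?J"
    by (simp add: weakly_ascending_def)
  then have Max_in: "Max ?J \<in> ?J"
    using fin by (intro Max_in) auto
  have "(i, Max ?J) \<in> weak_ascent_runs w"
    unfolding weak_ascent_runs_def
  proof (clarify, intro conjI allI impI)
    show "weakly_ascending w i (Max ?J)"
      using Max_in by simp
  next
    fix i' j' assume H: "i' \<le> i \<and> Max ?J \<le> j' \<and> weakly_ascending w i' j'"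
    have i': "i' = i"
    proof (rule ccontr)
      assume "i' \<noteq> i"
      with H have "i' < i" by simp
      then obtain p where p: "i = Suc p" "i' \<le> p"
        by (cases i) auto
      with start have "w ! Suc p < w ! p"
        by (auto simp: run_starts_def descents_def)
      moreover have "p < j'"
        using H Max_in p by (auto simp: weakly_ascending_def)
      ultimately show False
        using H p by (auto simp: weakly_ascending_def)
    qed
    then show "i' = i" .
    have "j' \<le> Max ?J"
      using H i' fin by (intro Max_ge) auto
    with H show "j' = Max ?J" by simp
  qed
  then show "i \<in> fst ` weak_ascent_runs w"
    by force
qed

lemma card_runs:
  assumes "w \<noteq> []"
  shows "card (weak_ascent_runs w) = Suc (card (descents w))"
proof -
  have "card (weak_ascent_runs w) = card (run_starts w)"
    by (metis card_image fst_runs_eq_run_starts[OF assms] inj_on_fst_runs)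
  also have "\<dots> = Suc (card (Suc ` descents w))"
    unfolding run_starts_def by (subst card_insert_disjoint) (auto simp: finite_descents)
  finally show ?thesis
    by (simp add: card_image)
qed

lemma weakly_flattened_iff:
  assumes "w \<noteq> []"
  shows "weakly_flattened w \<longleftrightarrow>
    (\<forall>i\<in>run_starts w. \<forall>i'\<in>run_starts w. i < i' \<longrightarrow> w ! i \<le> w ! i')"
  unfolding fst_runs_eq_run_starts[OF assms, symmetric] weakly_flattened_def
  by (simp add: case_prod_beta)

section \<open>Upper bounds on the number of descents\<close>

text \<open>Every letter is at least the leading term of its run, and the first leading term is minimal.\<close>

lemma weakly_flattened_first_le:
  assumes "weakly_flattened w" "i < length w"
  shows "w ! 0 \<le> w ! i"
proof -
  have ne: "w \<noteq> []" using assms(2) by auto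
  have "\<exists>p\<in>run_starts w. w ! p \<le> w ! i"
    using assms(2)
  proof (induction i)
    case 0
    then show ?case by (auto simp: run_starts_def)
  next
    case (Suc i)
    then obtain p where p: "p \<in> run_starts w" "w ! p \<le> w ! i" by auto
    show ?case
    proof (cases "i \<in> descents w")
      case True
      then show ?thesis by (auto simp: run_starts_def)
    next
      case False
      with Suc.prems have "w ! i \<le> w ! Suc i" by (simp add: descents_def)
      with p show ?thesis by (meson order_trans)
    qed
  qed
  then obtain p where p: "p \<in> run_starts w" "w ! p \<le> w ! i" by blast
  have "w ! 0 \<le> w ! p"
    using assms(1) p(1) unfolding weakly_flattened_iff[OF ne]
    by (cases "p = 0") (auto simp: run_starts_def)
  with p(2) show ?thesis by simp
qed

lemma zero_notin_descents:
  assumes "weakly_flattened w"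
  shows "0 \<notin> descents w"
  using weakly_flattened_first_le[OF assms, of 1] by (auto simp: descents_def)

text \<open>Two descents in a row would make the run between them a single letter exceeding the next
  leading term.\<close>

lemma no_consecutive_descents:
  assumes "weakly_flattened w" "i \<in> descents w"
  shows "Suc i \<notin> descents w"
proof
  assume d: "Suc i \<in> descents w"
  then have "w \<noteq> []" by (auto simp: descents_def)
  from assms(1) have "w ! Suc i \<le> w ! Suc (Suc i)"
    unfolding weakly_flattened_iff[OF \<open>w \<noteq> []\<close>]
    using assms(2) d by (auto simp: run_starts_def)
  with d show False by (simp add: descents_def)
qed

lemma card_descents_le_half:
  assumes "weakly_flattened w"
  shows "card (descents w) \<le> (length w - 1) div 2"
proof -
  have "descents w \<inter> Suc ` descents w = {}"
    using no_consecutive_descents[OF assms] by auto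
  then have "2 * card (descents w) = card (descents w \<union> Suc ` descents w)"
    by (subst card_Un_disjoint) (auto simp: finite_descents card_image)
  also have "\<dots> \<le> card {1..<length w}"
    by (rule card_mono)
      (use zero_notin_descents[OF assms] in \<open>auto simp: descents_def Suc_le_eq intro!: gr0I\<close>)
  finally show ?thesis by simp
qed

text \<open>The two letters of a descent differ, so one of them is not \<open>c\<close>; choosing such a position for
  every descent is injective because descents occupy disjoint pairs of positions.\<close>

lemma card_descents_le_neq:
  fixes c :: real
  assumes "weakly_flattened w"
  shows "card (descents w) \<le> card {i. 0 < i \<and> i < length w \<and> real (w ! i) \<noteq> c}"
proof -
  define h where "h i = (if real (w ! i) \<noteq> c then i else Suc i)" for i
  have "inj_on h (descents w)"
  proof (rule inj_onI)
    fix i j assume "i \<in> descents w" "j \<in> descents w" "h i = h j"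
    then show "i = j"
      using no_consecutive_descents[OF assms] by (auto simp: h_def split: if_splits)
  qed
  moreover have "h ` descents w \<subseteq> {i. 0 < i \<and> i < length w \<and> real (w ! i) \<noteq> c}"
    using zero_notin_descents[OF assms] by (auto simp: h_def descents_def intro!: gr0I)
  ultimately show ?thesis
    by (intro card_inj_on_le) auto
qed

lemma card_descents_le:
  assumes flat: "weakly_flattened w"
    and m: "m = num_below_median w" and M: "M = num_above_median w"
  shows "card (descents w) \<le> min (if m = 0 then M else m + M - 1) ((length w - 1) div 2)"
proof -
  let ?c = "median w"
  let ?B = "{i. i < length w \<and> real (w ! i) < ?c}"
  let ?A = "{i. i < length w \<and> real (w ! i) > ?c}"
  let ?N = "{i. 0 < i \<and> i < length w \<and> real (w ! i) \<noteq> ?c}"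
  have AB: "card (?B \<union> ?A) = m + M"
    unfolding m M num_below_median_def num_above_median_def by (intro card_Un_disjoint) auto
  have "card ?N \<le> (if m = 0 then M else m + M - 1)"
  proof (cases "m = 0")
    case True
    have "card ?N \<le> card (?B \<union> ?A)"
      by (rule card_mono) auto
    with AB True show ?thesis by simp
  next
    case False
    then have "?B \<noteq> {}"
      unfolding m num_below_median_def by (metis card.empty)
    then obtain i where i: "i < length w" "real (w ! i) < ?c" by blast
    from weakly_flattened_first_le[OF flat i(1)] i have "0 \<in> ?B" by auto
    moreover have "?N = (?B \<union> ?A) - {0}" by auto
    ultimately have "card ?N = card (?B \<union> ?A) - 1" by simp
    with AB False show ?thesis by simp
  qed
  with card_descents_le_neq[OF flat, of ?c] card_descents_le_half[OF flat] show ?thesis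
    by simp
qed

section \<open>Interleaving small and large letters\<close>

text \<open>Position in the sorted word of the letter at position \<open>p\<close> of the interleaved word: even
  positions below \<open>2 * k\<close> take the \<open>k\<close> smallest letters, odd ones the \<open>k\<close> largest, and the later
  positions the letters between these two groups.\<close>

definition interleave_index :: "nat \<Rightarrow> nat \<Rightarrow> nat \<Rightarrow> nat" where
  "interleave_index n k p =
    (if p < 2 * k then (if even p then p div 2 else n - k + p div 2) else p - k)"

definition interleave :: "nat \<Rightarrow> nat list \<Rightarrow> nat list" where
  "interleave k s = map (\<lambda>p. s ! interleave_index (length s) k p) [0..<length s]"

lemma length_interleave [simp]: "length (interleave k s) = length s"
  by (simp add: interleave_def)

lemma nth_interleave: "p < length s \<Longrightarrow> interleave k s ! p = s ! interleave_index (length s) k p"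
  by (simp add: interleave_def)

lemma mset_interleave:
  assumes "2 * k < length s"
  shows "mset (interleave k s) = mset s"
proof -
  let ?n = "length s" and ?g = "interleave_index (length s) k"
  have inj: "inj_on ?g {..<?n}"
  proof (rule inj_onI)
    fix p q assume pq: "p \<in> {..<?n}" "q \<in> {..<?n}" "?g p = ?g q"
    show "p = q"
      using pq assms unfolding interleave_index_def
      by (cases "even p"; cases "even q"; elim evenE oddE; simp split: if_splits)
  qed
  have "?g ` {..<?n} \<subseteq> {..<?n}"
    using assms by (auto simp: interleave_index_def)
  with inj have img: "?g ` {..<?n} = {..<?n}"
    by (intro endo_inj_surj) auto
  have "mset (map ?g [0..<?n]) = image_mset ?g (mset_set {..<?n})"
    by (simp add: lessThan_atLeast0)
  also have "\<dots> = mset_set {..<?n}"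
    using image_mset_mset_set[OF inj] img by simp
  also have "\<dots> = mset [0..<?n]"
    by (simp add: lessThan_atLeast0)
  finally have "mset (map ((!) s) (map ?g [0..<?n])) = mset (map ((!) s) [0..<?n])"
    by (metis mset_map)
  then show ?thesis
    by (simp add: interleave_def comp_def map_nth)
qed

text \<open>The hypothesis \<open>gap\<close> says that each large letter exceeds the small letter placed after
  it, so that the odd positions below \<open>2 * k\<close> are descents.\<close>

lemma descents_interleave:
  assumes "sorted s" and k: "2 * k < length s"
    and gap: "\<And>i. 1 \<le> i \<Longrightarrow> i \<le> k \<Longrightarrow> s ! i < s ! (length s - k - 1 + i)"
  shows "descents (interleave k s) = (\<lambda>i. 2 * i + 1) ` {..<k}"
proof (intro equalityI subsetI)
  fix p assume p: "p \<in> descents (interleave k s)"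
  then have p_lt: "Suc p < length s" by (simp add: descents_def)
  show "p \<in> (\<lambda>i. 2 * i + 1) ` {..<k}"
  proof (rule ccontr)
    assume not: "p \<notin> (\<lambda>i. 2 * i + 1) ` {..<k}"
    have "even p" if "p < 2 * k"
    proof (rule ccontr)
      assume "odd p"
      then obtain i where "p = 2 * i + 1" by (elim oddE)
      with that not show False by auto
    qed
    then have "interleave_index (length s) k p \<le> interleave_index (length s) k (Suc p)"
      using k by (auto simp: interleave_index_def)
    moreover have "interleave_index (length s) k (Suc p) < length s"
      using p_lt k by (auto simp: interleave_index_def)
    ultimately have "interleave k s ! p \<le> interleave k s ! Suc p"
      using p_lt \<open>sorted s\<close> by (simp add: nth_interleave sorted_nth_mono)
    with p show False by (simp add: descents_def)
  qed
next
  fix p assume "p \<in> (\<lambda>i. 2 * i + 1) ` {..<k}"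
  then obtain i where i: "i < k" "p = 2 * i + 1" by auto
  have "interleave_index (length s) k (Suc p) = Suc i"
    using i by (auto simp: interleave_index_def)
  moreover have "interleave_index (length s) k p = length s - k - 1 + Suc i"
    using i k by (auto simp: interleave_index_def)
  ultimately show "p \<in> descents (interleave k s)"
    using gap[of "Suc i"] i k by (simp add: descents_def nth_interleave)
qed

text \<open>The runs start at the even positions up to \<open>2 * k\<close>, which carry the first letters of \<open>s\<close> in
  order.\<close>

lemma
  assumes "sorted s" and k: "2 * k < length s"
    and gap: "\<And>i. 1 \<le> i \<Longrightarrow> i \<le> k \<Longrightarrow> s ! i < s ! (length s - k - 1 + i)"
  shows card_runs_interleave: "card (weak_ascent_runs (interleave k s)) = Suc k"
    and weakly_flattened_interleave: "weakly_flattened (interleave k s)"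
proof -
  let ?w = "interleave k s"
  have ne: "?w \<noteq> []" using k by (metis length_interleave list.size(3) not_less_zero)
  have D: "descents ?w = (\<lambda>i. 2 * i + 1) ` {..<k}"
    by (rule descents_interleave) fact+
  show "card (weak_ascent_runs ?w) = Suc k"
    unfolding card_runs[OF ne] D by (subst card_image) (auto simp: inj_on_def)
  have start: "\<exists>i\<le>k. p = 2 * i" if "p \<in> run_starts ?w" for p
  proof -
    from that consider "p = 0" | i where "i < k" "p = 2 * Suc i"
      unfolding run_starts_def D by auto
    then show ?thesis
    proof cases
      case 2
      then show ?thesis by (intro exI[of _ "Suc i"]) simp
    qed simp
  qed
  have nth: "?w ! (2 * i) = s ! i" if "i \<le> k" for i
    using that k by (auto simp: nth_interleave interleave_index_def)
  show "weakly_flattened ?w"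
    unfolding weakly_flattened_iff[OF ne]
  proof (intro ballI impI)
    fix p q assume "p \<in> run_starts ?w" "q \<in> run_starts ?w" "p < q"
    then obtain i j where "p = 2 * i" "q = 2 * j" "i \<le> k" "j \<le> k" "i < j"
      using start by (metis mult_less_cancel1)
    then show "?w ! p \<le> ?w ! q"
      using k \<open>sorted s\<close> by (simp add: nth sorted_nth_mono)
  qed
qed

section \<open>The median of a sorted word\<close>

text \<open>Both parities in one formula: for odd length the two middle positions coincide.\<close>

lemma median_sorted:
  assumes "sorted s" "s \<noteq> []"
  shows "median s = (real (s ! ((length s - 1) div 2)) + real (s ! (length s div 2))) / 2"
proof (cases "odd (length s)")
  case True
  then show ?thesis using assms by (auto simp: median_def sorted_sort_id elim!: oddE)
next
  case False
  then obtain x where "length s = 2 * x" by (auto elim: evenE)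
  moreover have "x > 0" using assms(2) calculation by (cases x) auto
  moreover have "(2 * x - 1) div 2 = x - 1" using \<open>x > 0\<close> by (cases x) auto
  ultimately show ?thesis using assms by (simp add: median_def sorted_sort_id)
qed

lemma num_below_median_le:
  assumes "j < length s" "sorted s" "median s \<le> real (s ! j)"
  shows "num_below_median s \<le> j"
proof -
  have "{i. i < length s \<and> real (s ! i) < median s} \<subseteq> {..<j}"
  proof (intro subsetI)
    fix i assume "i \<in> {i. i < length s \<and> real (s ! i) < median s}"
    with assms(3) have "i < length s" "\<not> s ! j \<le> s ! i" by auto
    with sorted_nth_mono[OF assms(2), of j i] show "i \<in> {..<j}"
      by (metis lessThan_iff linorder_not_less)
  qed
  then have "num_below_median s \<le> card {..<j}"
    unfolding num_below_median_def by (intro card_mono) auto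
  then show ?thesis by simp
qed

lemma num_above_median_le:
  assumes "j < length s" "sorted s" "real (s ! j) \<le> median s"
  shows "num_above_median s \<le> length s - 1 - j"
proof -
  have "{i. i < length s \<and> real (s ! i) > median s} \<subseteq> {Suc j..<length s}"
  proof (intro subsetI)
    fix i assume "i \<in> {i. i < length s \<and> real (s ! i) > median s}"
    with assms(3) have "i < length s" "\<not> s ! i \<le> s ! j" by auto
    with sorted_nth_mono[OF assms(2), of i j] assms(1) show "i \<in> {Suc j..<length s}"
      by (metis atLeastLessThan_iff linorder_not_less not_less_eq_eq)
  qed
  then have "num_above_median s \<le> card {Suc j..<length s}"
    unfolding num_above_median_def by (intro card_mono) auto
  then show ?thesis by simp
qed

lemma middle_bounds:
  assumes "sorted s" "s \<noteq> []"
  shows "real (s ! ((length s - 1) div 2)) \<le> median s" "median s \<le> real (s ! (length s div 2))"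
proof -
  have "s ! ((length s - 1) div 2) \<le> s ! (length s div 2)"
    using assms by (intro sorted_nth_mono) (auto intro: div_le_mono)
  then show "real (s ! ((length s - 1) div 2)) \<le> median s" "median s \<le> real (s ! (length s div 2))"
    unfolding median_sorted[OF assms] by auto
qed

lemma num_below_median_le_half:
  assumes "sorted s" "s \<noteq> []"
  shows "num_below_median s \<le> length s div 2"
  using num_below_median_le[OF _ assms(1) middle_bounds(2)[OF assms]] assms(2) by simp

text \<open>If no letter is below the median, then the lower middle letter, and hence also the upper one,
  equals the median.\<close>

lemma num_above_median_le_half:
  assumes "sorted s" "s \<noteq> []" "num_below_median s = 0"
  shows "num_above_median s \<le> (length s - 1) div 2"
proof -
  have lt: "(length s - 1) div 2 < length s"
    using assms(2) by (cases s) auto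
  have "{i. i < length s \<and> real (s ! i) < median s} = {}"
    using assms(3) by (simp add: num_below_median_def)
  then have "median s \<le> real (s ! ((length s - 1) div 2))"
    using lt by (metis (mono_tags, lifting) empty_iff linorder_not_less mem_Collect_eq)
  then have "real (s ! (length s div 2)) \<le> median s"
    using median_sorted[OF assms(1,2)] by (simp add: field_simps)
  from num_above_median_le[OF _ assms(1) this] assms(2)
  have "num_above_median s \<le> length s - 1 - length s div 2" by simp
  then show ?thesis by linarith
qed

text \<open>Equality of the two letters would make \<open>s\<close> constant on \<open>n - k\<close> positions starting at \<open>i\<close>.
  These include both middle positions, so the value is the median; then at most \<open>i\<close> letters are below
  it and at most \<open>k - i\<close> above it, against the choice of \<open>k\<close>.\<close>

lemma sorted_gap:
  assumes "sorted s" and i: "1 \<le> i" "i \<le> k" and k: "2 * k < length s"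
    and le: "k \<le> (if num_below_median s = 0 then num_above_median s
                   else num_below_median s + num_above_median s - 1)"
  shows "s ! i < s ! (length s - k - 1 + i)"
proof (rule ccontr)
  let ?n = "length s" and ?j = "length s - k - 1 + i"
  assume "\<not> s ! i < s ! ?j"
  then have ge: "s ! ?j \<le> s ! i" by simp
  have j: "?j < ?n" using i k by linarith
  have ne: "s \<noteq> []" using k by auto
  have const: "s ! p = s ! i" if "i \<le> p" "p \<le> ?j" for p
    using that ge j sorted_nth_mono[OF \<open>sorted s\<close>, of i p] sorted_nth_mono[OF \<open>sorted s\<close>, of p ?j]
    by linarith
  have "s ! ((?n - 1) div 2) = s ! i" "s ! (?n div 2) = s ! i"
    by (rule const; use i k in linarith)+
  then have med: "median s = real (s ! i)"
    using median_sorted[OF \<open>sorted s\<close> ne] by simp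
  have "num_below_median s \<le> i"
    using num_below_median_le[of i s] med \<open>sorted s\<close> i k by simp
  moreover have "num_above_median s \<le> ?n - 1 - ?j"
    using num_above_median_le[of ?j s] med \<open>sorted s\<close> j ge by simp
  ultimately show False
    using i k le by (auto split: if_splits)
qed

section \<open>Invariance under rearrangement\<close>

lemma card_nth_eq_size_filter_mset:
  "card {i. i < length w \<and> P (w ! i)} = size (filter_mset P (mset w))"
  by (metis length_filter_conv_card mset_filter size_mset)

lemma median_mset_cong:
  assumes "mset f = mset g"
  shows "median f = median g"
proof -
  have "sort f = sort g" using assms by (metis sorted_list_of_multiset_mset)
  moreover have "length f = length g" using assms by (metis size_mset)
  ultimately show ?thesis by (simp add: median_def)
qed

lemma num_below_median_mset_cong:
  "mset f = mset g \<Longrightarrow> num_below_median f = num_below_median g"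
  using median_mset_cong[of f g]
  by (simp add: num_below_median_def card_nth_eq_size_filter_mset[where P = "\<lambda>x. real x < _"])

lemma num_above_median_mset_cong:
  "mset f = mset g \<Longrightarrow> num_above_median f = num_above_median g"
  using median_mset_cong[of f g]
  by (simp add: num_above_median_def card_nth_eq_size_filter_mset[where P = "\<lambda>x. real x > _"])

lemma fubini_ranking_iff_set:
  "fubini_ranking n r \<longleftrightarrow> length r = n \<and> set r \<subseteq> {1..n} \<and>
     (\<forall>x\<in>set r. x = 1 + size (filter_mset (\<lambda>y. y < x) (mset r)))"
  unfolding fubini_ranking_def all_set_conv_all_nth
  by (auto simp: card_nth_eq_size_filter_mset[where P = "\<lambda>y. y < _"])

lemma fubini_ranking_mset_cong:
  assumes "mset f = mset g"
  shows "fubini_ranking n f \<longleftrightarrow> fubini_ranking n g"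
proof -
  have "set f = set g" "length f = length g"
    using assms by (metis set_mset_mset, metis size_mset)
  with assms show ?thesis by (simp add: fubini_ranking_iff_set)
qed

lemma content_eq_iff_mset_eq:
  assumes "length f = n" "set f \<subseteq> {1..n}" "length g = n" "set g \<subseteq> {1..n}"
  shows "content f = content g \<longleftrightarrow> mset f = mset g"
proof
  assume "content f = content g"
  then have "\<forall>x\<in>set [1..<n + 1]. count_list f x = count_list g x"
    using assms(1,3) by (simp only: content_def map_eq_conv)
  then have inside: "count_list f x = count_list g x" if "x \<in> {1..n}" for x
    using that by (simp only: set_upt) auto
  have "count_list f x = count_list g x" for x
  proof (cases "x \<in> {1..n}")
    case False
    with assms have "x \<notin> set f" "x \<notin> set g" by auto
    then show ?thesis by (simp add: count_list_0_iff)
  qed (rule inside)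
  then show "mset f = mset g"
    by (intro multiset_eqI) (simp add: count_mset)
next
  assume "mset f = mset g"
  then have "count_list f x = count_list g x" for x
    by (metis count_mset)
  with assms show "content f = content g" by (simp add: content_def)
qed

section \<open>The maximum number of runs\<close>

lemma max_runs_eq:
  assumes n: "n \<ge> 1" and r: "fubini_ranking n r"
    and m: "m = num_below_median r" and M: "M = num_above_median r"
  shows "max_runs n (content r) = Suc (min (if m = 0 then M else m + M - 1) ((n - 1) div 2))"
proof -
  define k where "k = min (if m = 0 then M else m + M - 1) ((n - 1) div 2)"
  define F where "F = {f. fubini_ranking n f \<and> weakly_flattened f \<and> content f = content r}"
  have len: "length r = n" and set: "set r \<subseteq> {1..n}"
    using r by (simp_all add: fubini_ranking_def)
  have "F \<subseteq> {f. set f \<subseteq> {1..n} \<and> length f = n}"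
    by (auto simp: F_def fubini_ranking_def)
  then have fin: "finite F"
    by (rule finite_subset) (simp add: finite_lists_length_eq)
  have upper: "card (weak_ascent_runs f) \<le> Suc k" if "f \<in> F" for f
  proof -
    have f: "length f = n" "set f \<subseteq> {1..n}" "weakly_flattened f" "content f = content r"
      using that by (simp_all add: F_def fubini_ranking_def)
    have mset: "mset f = mset r"
      using f(4) content_eq_iff_mset_eq[OF f(1,2) len set] by simp
    have "card (descents f) \<le> k"
      using card_descents_le[OF f(3), of m M] unfolding k_def f(1) m M
      by (simp only: num_below_median_mset_cong[OF mset] num_above_median_mset_cong[OF mset])
    moreover have "f \<noteq> []" using f(1) n by auto
    ultimately show ?thesis using card_runs by simp
  qed
  have attained: "Suc k \<in> (\<lambda>f. card (weak_ascent_runs f)) ` F"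
  proof -
    define s where "s = sort r"
    have s: "sorted s" "mset s = mset r" "length s = n"
      using len by (simp_all add: s_def)
    have "k \<le> (n - 1) div 2" by (simp add: k_def)
    then have k: "2 * k < length s" using s(3) n by linarith
    have k_le: "k \<le> (if num_below_median s = 0 then num_above_median s
        else num_below_median s + num_above_median s - 1)"
      unfolding num_below_median_mset_cong[OF s(2)] num_above_median_mset_cong[OF s(2)] k_def m M
      by (rule min.cobounded1)
    have gap: "s ! i < s ! (length s - k - 1 + i)" if "1 \<le> i" "i \<le> k" for i
      by (rule sorted_gap[OF s(1) that k k_le])
    have mset: "mset (interleave k s) = mset r"
      using mset_interleave[OF k] s(2) by simp
    have fub: "fubini_ranking n (interleave k s)"
      using r fubini_ranking_mset_cong[OF mset] by simp
    then have "content (interleave k s) = content r"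
      using mset content_eq_iff_mset_eq[OF _ _ len set] by (simp add: fubini_ranking_def)
    moreover have "weakly_flattened (interleave k s)"
      by (rule weakly_flattened_interleave[OF s(1) k]) (rule gap)
    ultimately have "interleave k s \<in> F"
      using fub by (simp add: F_def)
    moreover have "card (weak_ascent_runs (interleave k s)) = Suc k"
      by (rule card_runs_interleave[OF s(1) k]) (rule gap)
    ultimately show ?thesis by (metis image_eqI)
  qed
  have "max_runs n (content r) = Max ((\<lambda>f. card (weak_ascent_runs f)) ` F)"
    unfolding max_runs_def F_def by (simp only: setcompr_eq_image)
  also have "\<dots> = Suc k"
    using fin upper attained by (intro Max_eqI) auto
  finally show ?thesis by (simp only: k_def)
qed

text \<open>The four cases only separate the signs of \<open>m\<close> and \<open>M\<close>. In the second and third one the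
  bound \<open>(n - 1) div 2\<close> is absorbed because \<open>M\<close> and \<open>m - 1\<close>, respectively, do not exceed
  it.\<close>

theorem theorem3p12:
  fixes n :: nat and a r :: "nat list" and m M R :: nat
  assumes "n \<ge> 1"
    and "weak_composition n a"
    and "fubini_ranking n r" and "content r = a"
  defines "m \<equiv> num_below_median r"
    and "M \<equiv> num_above_median r"
    and "R \<equiv> max_runs n a"
  shows "\<exists>!k. k < 4 \<and>
    [m = 0 \<and> M = 0 \<and> R = 1,
     0 = m \<and> m < M \<and> R = M + 1,
     0 = M \<and> M < m \<and> R = m,
     m > 0 \<and> M > 0 \<and> int R = min (int (m + M)) \<lceil>real n / 2\<rceil>] ! k"
proof -
  have R: "R = Suc (min (if m = 0 then M else m + M - 1) ((n - 1) div 2))"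
    using max_runs_eq[OF assms(1,3) m_def[THEN meta_eq_to_obj_eq] M_def[THEN meta_eq_to_obj_eq]]
      assms(4) by (simp add: R_def)
  have len: "length r = n" using assms(3) by (simp add: fubini_ranking_def)
  then have ne: "sort r \<noteq> []" using assms(1) by (metis length_sort list.size(3) not_one_le_zero)
  have s: "num_below_median (sort r) = m" "num_above_median (sort r) = M"
    unfolding m_def M_def
    by (rule num_below_median_mset_cong num_above_median_mset_cong, simp)+
  have m_le: "m \<le> n div 2"
    using num_below_median_le_half[of "sort r"] ne s len by simp
  have M_le: "M \<le> (n - 1) div 2" if "m = 0"
    using num_above_median_le_half[of "sort r"] ne s len that by simp
  have ceil: "\<lceil>real n / 2\<rceil> = int (Suc ((n - 1) div 2))"
    using assms(1) by (intro ceiling_unique) (auto simp: field_simps; linarith)+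
  have four: "k = 0 \<or> k = 1 \<or> k = 2 \<or> k = 3" if "k < 4" for k :: nat
    using that by auto
  consider "m = 0" "M = 0" | "m = 0" "M > 0" | "m > 0" "M = 0" | "m > 0" "M > 0" by blast
  then show ?thesis
  proof cases
    case 1
    then show ?thesis using R by (intro ex1I[of _ 0]) (auto dest!: four)
  next
    case 2
    then show ?thesis using R M_le by (intro ex1I[of _ 1]) (auto dest!: four)
  next
    case 3
    then have "R = m" using R m_le by simp
    with 3 show ?thesis by (intro ex1I[of _ 2]) (auto dest!: four)
  next
    case 4
    then have "int R = min (int (m + M)) \<lceil>real n / 2\<rceil>"
      unfolding ceil using R by (auto simp: min_def)
    with 4 show ?thesis by (intro ex1I[of _ 3]) (auto dest!: four)
  qed
qed

end
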